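(* Every color graph is isomorphic to a vertex-induced subgraph of a (finite-dimensional) hypercube graph.
   Context: Let $V=\mathbb{Z}_2\times\mathbb{Z}_2$ be the Klein four-group with elements $0,1,2,3$ ($1+2+3=0$, $x+x=0$). Color graphs can be described as follows. Let $n\geq 3$ and let $P$ be a convex $n$-gon whose vertices are colored by elements of $V$ so that adjacent polygon vertices have different colors. A triangulation of $P$ (using only the vertices of $P$) is compatible with the coloring if every diagonal of the triangulation joins two differently colored vertices. The color graph of this coloring has as vertices the compatible triangulations, two being adjacent iff they differ by a single diagonal flip (removing one diagonal and inserting the other diagonal of the resulting quadrilateral). (Equivalently, in dual terms: for a color vector ${\bf c}$ of nonzero elements of $V$, the color graph has as vertices the rooted planar binary trees whose leaf edges, colored by ${\bf c}$ from left to right, extend to an edge coloring by $\{1,2,3\}$ with the three colors at each internal vertex summing to $0$, with edges given by rotations; the leaf colors are the sums of the colors of the two polygon vertices nearest each leaf.) For a finite set $S$, the hypercube $\mathcal{H}(S)$ has vertex set the power set of $S$, with $A,B$ adjacent iff the symmetric difference $A\Delta B$ is a singleton. *)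

theory Defs
  imports "Graph_Theory.Graph_Theory" "HOL-Library.Z2" "HOL-Library.Product_Plus"
begin

type_synonym klein = "bit \<times> bit"

lemma klein_add_self: "(x :: klein) + x = 0"
  by (cases x) (simp add: zero_prod_def)

text \<open>
  A convex \<open>n\<close>-gon is represented by its vertices \<open>0, \<dots>, n - 1\<close> in cyclic order, and a segment
  between two distinct vertices by the set of its end points. Because the vertices are in convex
  position, two segments meet in their relative interiors iff their end points interlace.
\<close>

definition polygon_sides :: "nat \<Rightarrow> nat set set" where
  "polygon_sides n = {{i, Suc i mod n} | i. i < n}"

definition diagonals :: "nat \<Rightarrow> nat set set" where
  "diagonals n = {{i, j} | i j. i < n \<and> j < n \<and> i \<noteq> j} - polygon_sides n"

definition crossing :: "nat set \<Rightarrow> nat set \<Rightarrow> bool" where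
  "crossing d e \<longleftrightarrow> (\<exists>p q r s. p < q \<and> q < r \<and> r < s \<and>
     ((d = {p, r} \<and> e = {q, s}) \<or> (d = {q, s} \<and> e = {p, r})))"

definition noncrossing :: "nat set set \<Rightarrow> bool" where
  "noncrossing T \<longleftrightarrow> (\<forall>d \<in> T. \<forall>e \<in> T. \<not> crossing d e)"

text \<open>A triangulation is given by its set of diagonals.\<close>

definition triangulation :: "nat \<Rightarrow> nat set set \<Rightarrow> bool" where
  "triangulation n T \<longleftrightarrow> T \<subseteq> diagonals n \<and> noncrossing T \<and>
     (\<forall>T'. T \<subseteq> T' \<and> T' \<subseteq> diagonals n \<and> noncrossing T' \<longrightarrow> T' = T)"

text \<open>
  \<open>p, q, r, s\<close> is the quadrilateral that results from removing one of its diagonals from the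
  triangulation \<open>T\<close>: each of its sides is a diagonal in \<open>T\<close> or a side of the polygon.
\<close>

definition flip :: "nat \<Rightarrow> nat set set \<Rightarrow> nat set set \<Rightarrow> bool" where
  "flip n T T' \<longleftrightarrow> (\<exists>p q r s. p < q \<and> q < r \<and> r < s \<and> s < n \<and>
     {{p, q}, {q, r}, {r, s}, {s, p}} \<subseteq> T \<union> polygon_sides n \<and>
     (({p, r} \<in> T \<and> T' = insert {q, s} (T - {{p, r}})) \<or>
      ({q, s} \<in> T \<and> T' = insert {p, r} (T - {{q, s}}))))"

definition polygon_coloring :: "nat \<Rightarrow> (nat \<Rightarrow> klein) \<Rightarrow> bool" where
  "polygon_coloring n c \<longleftrightarrow> (\<forall>i < n. c i \<noteq> c (Suc i mod n))"

definition compatible_triangulations :: "nat \<Rightarrow> (nat \<Rightarrow> klein) \<Rightarrow> nat set set set" where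
  "compatible_triangulations n c = {T. triangulation n T \<and> (\<forall>d \<in> T. inj_on c d)}"

text \<open>
  Undirected simple graphs are symmetric, loop-free digraphs without parallel arcs, see
  \<open>pair_graph_color_graph\<close> and \<open>pair_graph_hypercube\<close> below.
\<close>

definition color_graph :: "nat \<Rightarrow> (nat \<Rightarrow> klein) \<Rightarrow> nat set set pair_pre_digraph" where
  "color_graph n c = \<lparr> pverts = compatible_triangulations n c,
     parcs = {(T, T'). T \<in> compatible_triangulations n c \<and> T' \<in> compatible_triangulations n c \<and>
                       flip n T T'} \<rparr>"

definition hypercube :: "'a set \<Rightarrow> 'a set pair_pre_digraph" where
  "hypercube S = \<lparr> pverts = Pow S,
     parcs = {(A, B). A \<subseteq> S \<and> B \<subseteq> S \<and> (\<exists>x. (A - B) \<union> (B - A) = {x})} \<rparr>"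

lemma finite_diagonals: "finite (diagonals n)"
proof (rule finite_subset)
  show "diagonals n \<subseteq> Pow {..<n}" by (auto simp: diagonals_def)
qed simp

lemma finite_compatible_triangulations: "finite (compatible_triangulations n c)"
proof (rule finite_subset)
  show "compatible_triangulations n c \<subseteq> Pow (diagonals n)"
    by (auto simp: compatible_triangulations_def triangulation_def)
qed (simp add: finite_diagonals)

lemma flip_sym_neq:
  assumes T: "noncrossing T" and fl: "flip n T T'"
  shows "flip n T' T" "T \<noteq> T'"
proof -
  from fl obtain p q r s where o: "p < q" "q < r" "r < s" "s < n"
    and sides: "{{p, q}, {q, r}, {r, s}, {s, p}} \<subseteq> T \<union> polygon_sides n"
    and T': "({p, r} \<in> T \<and> T' = insert {q, s} (T - {{p, r}})) \<or>
             ({q, s} \<in> T \<and> T' = insert {p, r} (T - {{q, s}}))"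
    unfolding flip_def by (elim exE conjE) (rule that)
  have "crossing {p, r} {q, s}" using o unfolding crossing_def
    by (intro exI[of _ p] exI[of _ q] exI[of _ r] exI[of _ s]) simp
  with T have nb: "\<not> ({p, r} \<in> T \<and> {q, s} \<in> T)" unfolding noncrossing_def by blast
  have ne: "{p, r} \<notin> {{p, q}, {q, r}, {r, s}, {s, p}}" "{q, s} \<notin> {{p, q}, {q, r}, {r, s}, {s, p}}"
    "{p, r} \<noteq> {q, s}"
    using o by (auto simp: doubleton_eq_iff)
  have neq: "flip n T' T \<and> T \<noteq> T'"
    if e: "d \<in> T" "T' = insert d' (T - {d})" "d' \<notin> T" "d \<noteq> d'"
      "(d = {p, r} \<and> d' = {q, s}) \<or> (d = {q, s} \<and> d' = {p, r})" for d d'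
  proof
    have "d \<notin> {{p, q}, {q, r}, {r, s}, {s, p}}" using e(5) ne by metis
    then have sides': "{{p, q}, {q, r}, {r, s}, {s, p}} \<subseteq> T' \<union> polygon_sides n"
      using sides unfolding e(2) insert_subset by blast
    have "d' \<in> T'" "T = insert d (T' - {d'})" using e(1-4) by blast+
    then have "({p, r} \<in> T' \<and> T = insert {q, s} (T' - {{p, r}})) \<or>
        ({q, s} \<in> T' \<and> T = insert {p, r} (T' - {{q, s}}))"
      using e(5) by metis
    then show "flip n T' T" unfolding flip_def using o sides'
      by (intro exI[of _ p] exI[of _ q] exI[of _ r] exI[of _ s] conjI)
    show "T \<noteq> T'" using e(1-4) by blast
  qed
  have "flip n T' T \<and> T \<noteq> T'"
    using T'
  proof (elim disjE conjE)
    assume "{p, r} \<in> T" "T' = insert {q, s} (T - {{p, r}})"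
    with neq[of "{p, r}" "{q, s}"] nb ne(3) show ?thesis by simp
  next
    assume "{q, s} \<in> T" "T' = insert {p, r} (T - {{q, s}})"
    with neq[of "{q, s}" "{p, r}"] nb ne(3)[symmetric] show ?thesis by simp
  qed
  then show "flip n T' T" "T \<noteq> T'" by simp_all
qed

lemma pair_graph_color_graph: "pair_graph (color_graph n c)"
proof -
  have nc: "noncrossing T" if "T \<in> compatible_triangulations n c" for T
    using that by (simp add: compatible_triangulations_def triangulation_def)
  have "finite (parcs (color_graph n c))"
    by (rule finite_subset[where B = "compatible_triangulations n c \<times> compatible_triangulations n c"])
      (auto simp: color_graph_def finite_compatible_triangulations)
  moreover have "symmetric (color_graph n c)"
    using nc flip_sym_neq(1) by (auto simp: symmetric_def color_graph_def intro!: symI)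
  moreover have "fst e \<noteq> snd e" if "e \<in> parcs (color_graph n c)" for e
    using that nc flip_sym_neq(2) by (auto simp: color_graph_def)
  ultimately show ?thesis
    by unfold_locales (auto simp: color_graph_def finite_compatible_triangulations)
qed

lemma pair_graph_hypercube:
  assumes "finite S"
  shows "pair_graph (hypercube S)"
proof -
  have "finite (parcs (hypercube S))"
    by (rule finite_subset[where B = "Pow S \<times> Pow S"]) (auto simp: hypercube_def assms)
  moreover have "symmetric (hypercube S)"
    by (auto simp: symmetric_def hypercube_def Un_commute intro!: symI)
  moreover have "fst e \<noteq> snd e" if "e \<in> parcs (hypercube S)" for e
    using that by (auto simp: hypercube_def)
  moreover have "finite (pverts (hypercube S))"
    by (simp add: hypercube_def assms)
  moreover have "fst e \<in> pverts (hypercube S)" "snd e \<in> pverts (hypercube S)"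
    if "e \<in> parcs (hypercube S)" for e
    using that by (auto simp: hypercube_def)
  ultimately show ?thesis
    by unfold_locales
qed

end

theory Submission
  imports Defs
begin

text \<open>
  Send a compatible triangulation to the set of those of its diagonals that have no end point of
  colour \<open>0\<close>. The four vertices of a flipped quadrilateral carry all four colours, so exactly one of
  its two diagonals avoids the colour \<open>0\<close> and a flip changes exactly one element of the image.
  Conversely, cut the polygon along the diagonals avoiding \<open>0\<close>. Two triangles of one piece that
  share a diagonal share a vertex of colour \<open>0\<close>, so each piece is a single triangle or a fan around
  its only vertex of colour \<open>0\<close>. Hence the image determines the triangulation, and adding one
  diagonal to the image cuts a single triangle off such a fan, which is a flip.
\<close>

section \<open>Maximal noncrossing systems of chords\<close>

text \<open>Only pairs with smaller index first matter for \<open>A\<close>, so interlacing becomes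
  a chain of inequalities. The locale is instantiated with sides and diagonals together, relabelled
  so that a chosen vertex has index 0.\<close>

locale maximal_noncrossing =
  fixes n :: nat and A :: "nat \<Rightarrow> nat \<Rightarrow> bool"
  assumes side: "Suc i < n \<Longrightarrow> A i (Suc i)"
    and closing_side: "A 0 (n - 1)"
    and not_cross: "i < k \<Longrightarrow> k < j \<Longrightarrow> j < l \<Longrightarrow> l < n \<Longrightarrow> A i j \<Longrightarrow> A k l \<Longrightarrow> False"
    and maximal: "i < j \<Longrightarrow> j < n \<Longrightarrow> \<not> A i j \<Longrightarrow>
      \<exists>k l. k < l \<and> l < n \<and> A k l \<and> (i < k \<and> k < j \<and> j < l \<or> k < i \<and> i < l \<and> l < j)"
begin

text \<open>The apex is the last neighbour of \<open>a\<close> before \<open>b\<close>. A segment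
  separating \<open>x\<close> from \<open>b\<close> would cross \<open>a b\<close> or
  \<open>a x\<close>, or would be a later neighbour of \<open>a\<close>.\<close>

lemma triangle_below:
  assumes ab: "A a b" "Suc a < b" "b < n"
  obtains x where "a < x" "x < b" "A a x" "A x b"
proof -
  define x where "x = Max {x. a < x \<and> x < b \<and> A a x}"
  have fin: "finite {x. a < x \<and> x < b \<and> A a x}" by simp
  \<comment> \<open>The polygon side at \<open>a\<close> makes the set nonempty, so that
    \<open>Max\<close> is meaningful.\<close>
  have "Suc a \<in> {x. a < x \<and> x < b \<and> A a x}" using side[of a] ab by simp
  then have x: "a < x" "x < b" "A a x" using Max_in[OF fin] unfolding x_def by blast+
  have x_max: "u \<le> x" if "a < u" "u < b" "A a u" for u
    unfolding x_def using that by (intro Max_ge[OF fin]) simp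
  have "A x b"
  proof (rule ccontr)
    assume "\<not> A x b"
    then obtain k l where kl: "k < l" "l < n" "A k l"
      and cr: "x < k \<and> k < b \<and> b < l \<or> k < x \<and> x < l \<and> l < b"
      using maximal[of x b] x ab by blast
    from cr show False
    proof
      assume "x < k \<and> k < b \<and> b < l"
      then show False using not_cross[of a k b l] kl ab x by simp
    next
      assume c: "k < x \<and> x < l \<and> l < b"
      consider "k < a" | "k = a" | "a < k" by linarith
      then show False
      proof cases
        case 1 then show False using not_cross[of k a l b] kl ab x c by simp
      next
        case 2 then show False using x_max[of l] kl c x by simp
      next
        case 3 then show False using not_cross[of a k x l] kl x c by simp
      qed
    qed
  qed
  with x show thesis by (intro that)
qed

text \<open>The missing segment \<open>0 x\<close> leaves vertex 0 inside one triangle: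
  \<open>a\<close> and \<open>b\<close> are the neighbours of 0 closest to \<open>x\<close> on
  either side. A segment crossing \<open>a b\<close> would cross \<open>0 a\<close> or
  \<open>0 b\<close>, or would give a neighbour of 0 between them.\<close>

lemma triangle_at_origin:
  assumes x: "0 < x" "x < n" "\<not> A 0 x"
  obtains a b where "0 < a" "a < x" "x < b" "b < n" "A 0 a" "A 0 b" "A a b"
proof -
  have "x \<noteq> 1" using side[of 0] x by auto
  moreover have "x \<noteq> n - 1" using closing_side x by auto
  ultimately have x': "1 < x" "x < n - 1" using x by linarith+
  define a where "a = Max {a. 0 < a \<and> a < x \<and> A 0 a}"
  have fin: "finite {a. 0 < a \<and> a < x \<and> A 0 a}" by simp
  have "1 \<in> {a. 0 < a \<and> a < x \<and> A 0 a}" using side[of 0] x' by simp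
  then have a: "0 < a" "a < x" "A 0 a" using Max_in[OF fin] unfolding a_def by blast+
  have a_max: "u \<le> a" if "0 < u" "u < x" "A 0 u" for u
    unfolding a_def using that by (intro Max_ge[OF fin]) simp
  define b where "b = Min {b. x < b \<and> b < n \<and> A 0 b}"
  have fin': "finite {b. x < b \<and> b < n \<and> A 0 b}" by simp
  have "n - 1 \<in> {b. x < b \<and> b < n \<and> A 0 b}" using closing_side x' by simp
  then have b: "x < b" "b < n" "A 0 b" using Min_in[OF fin'] unfolding b_def by blast+
  have b_min: "b \<le> u" if "x < u" "u < n" "A 0 u" for u
    unfolding b_def using that by (intro Min_le[OF fin']) simp
  have "A a b"
  proof (rule ccontr)
    assume "\<not> A a b"
    then obtain k l where kl: "k < l" "l < n" "A k l"
      and cr: "a < k \<and> k < b \<and> b < l \<or> k < a \<and> a < l \<and> l < b"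
      using maximal[of a b] a b by (metis less_trans)
    from cr show False
    proof
      assume "a < k \<and> k < b \<and> b < l"
      then show False using not_cross[of 0 k b l] kl a b by simp
    next
      assume c: "k < a \<and> a < l \<and> l < b"
      show False
      proof (cases "k = 0")
        case True
        consider "l < x" | "l = x" | "x < l" by linarith
        then show False using True c kl x a_max[of l] b_min[of l] by cases auto
      next
        case False
        then show False using not_cross[of 0 k a l] kl a c by simp
      qed
    qed
  qed
  with a b show thesis by (intro that)
qed

end

section \<open>Triangulations seen from a vertex\<close>

text \<open>Decides crossing by inequalities when the order of the end points is unknown, as happens
  after a rotation.\<close>

lemma crossing_doubleton:
  "crossing {a, b} {u, v} \<longleftrightarrow>
     min a b < min u v \<and> min u v < max a b \<and> max a b < max u v \<or>
     min u v < min a b \<and> min a b < max u v \<and> max u v < max a b"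
  (is "?L \<longleftrightarrow> ?R")
proof
  assume ?L
  then show ?R
    unfolding crossing_def by (elim exE) (auto simp: doubleton_eq_iff min_def max_def)
next
  have set_min_max: "{min x y, max x y} = {x, y}" for x y :: nat
    by (auto simp: min_def max_def)
  assume ?R
  then show ?L
  proof
    assume "min a b < min u v \<and> min u v < max a b \<and> max a b < max u v"
    then show ?L unfolding crossing_def
      by (intro exI[of _ "min a b"] exI[of _ "min u v"] exI[of _ "max a b"] exI[of _ "max u v"])
        (simp add: set_min_max)
  next
    assume "min u v < min a b \<and> min a b < max u v \<and> max u v < max a b"
    then show ?L unfolding crossing_def
      by (intro exI[of _ "min u v"] exI[of _ "min a b"] exI[of _ "max u v"] exI[of _ "max a b"])
        (simp add: set_min_max)
  qed
qed

lemma crossing_sym: "crossing d e \<longleftrightarrow> crossing e d"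
  unfolding crossing_def by blast

text \<open>The vertex \<open>i\<close> steps after \<open>p\<close>: the relabelling that lets any
  vertex \<open>p\<close> play the role of index 0.\<close>

definition rot :: "nat \<Rightarrow> nat \<Rightarrow> nat \<Rightarrow> nat" where
  "rot n p i = (i + p) mod n"

lemma rot_less: "0 < n \<Longrightarrow> rot n p i < n"
  by (simp add: rot_def)

lemma rot_0: "p < n \<Longrightarrow> rot n p 0 = p"
  by (simp add: rot_def)

lemma rot_if:
  assumes "i < n" "p < n"
  shows "rot n p i = (if i + p < n then i + p else i + p - n)"
  using assms by (simp add: rot_def mod_if)

lemma rot_eq_iff:
  assumes "p < n" "i < n" "j < n"
  shows "rot n p i = rot n p j \<longleftrightarrow> i = j"
  using assms by (auto simp: rot_if split: if_splits)

lemma rot_surj: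
  assumes "p < n" "u < n"
  obtains i where "i < n" "u = rot n p i"
proof
  show "(if p \<le> u then u - p else u + n - p) < n" using assms by auto
  then show "u = rot n p (if p \<le> u then u - p else u + n - p)"
    using assms by (auto simp: rot_if)
qed

text \<open>Interlacing depends only on the cyclic order, which a rotation preserves.\<close>

lemma crossing_rot:
  assumes "p < n" "i < n" "j < n" "k < n" "l < n"
  shows "crossing {rot n p i, rot n p j} {rot n p k, rot n p l} \<longleftrightarrow> crossing {i, j} {k, l}"
proof -
  \<comment> \<open>The order is kept if both or neither index wraps past \<open>n\<close>;
    otherwise the wrapped one becomes the smaller.\<close>
  have *: "rot n p i < rot n p j \<longleftrightarrow>
      (if i + p < n \<longleftrightarrow> j + p < n then i < j else n \<le> i + p)" if "i < n" "j < n" for i j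
    using that assms(1) by (auto simp: rot_if)
  show ?thesis
    unfolding crossing_doubleton min_def max_def
    using assms *[of i j] *[of i k] *[of i l] *[of j k] *[of j l] *[of k l]
      *[of j i] *[of k i] *[of l i] *[of k j] *[of l j] *[of l k]
    by (smt (verit) linorder_not_less nat_add_left_cancel_less add.commute le_less_trans
        order_le_less rot_eq_iff)
qed

section \<open>Sides and diagonals of a triangulation as a maximal noncrossing system\<close>

lemma crossing_irrefl: "\<not> crossing d d"
  unfolding crossing_def by (auto simp: doubleton_eq_iff)

text \<open>The ends of a side are consecutive, or are 0 and \<open>n - 1\<close>, so they separate
  no two other vertices.\<close>

lemma polygon_side_not_crossing:
  assumes "e \<in> polygon_sides n" "u < n" "v < n"
  shows "\<not> crossing e {u, v}"
proof -
  from assms(1) obtain i where i: "i < n" "e = {i, Suc i mod n}"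
    unfolding polygon_sides_def by blast
  have "Suc i mod n = (if Suc i < n then Suc i else 0)" using i by (auto simp: mod_Suc)
  then show ?thesis
    using assms(2,3) i unfolding i(2) crossing_doubleton by (auto simp: min_def max_def)
qed

lemma segment_doubleton:
  assumes "3 \<le> n" "e \<in> diagonals n \<union> polygon_sides n"
  obtains u v where "e = {u, v}" "u < n" "v < n" "u \<noteq> v"
proof (cases "e \<in> diagonals n")
  case True
  then show thesis using that unfolding diagonals_def by blast
next
  case False
  with assms obtain i where i: "i < n" "e = {i, Suc i mod n}"
    unfolding polygon_sides_def by blast
  then have "i \<noteq> Suc i mod n" "Suc i mod n < n" using assms(1) by (auto simp: mod_Suc)
  with i that show thesis by blast
qed

lemma segment_not_crossing:
  assumes "3 \<le> n" "triangulation n T"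
    and "d \<in> T \<union> polygon_sides n" "e \<in> T \<union> polygon_sides n"
  shows "\<not> crossing d e"
proof -
  have T: "T \<subseteq> diagonals n" "noncrossing T" using assms(2) by (auto simp: triangulation_def)
  obtain u v where uv: "d = {u, v}" "u < n" "v < n"
    using segment_doubleton[of n d] assms T by blast
  obtain u' v' where uv': "e = {u', v'}" "u' < n" "v' < n"
    using segment_doubleton[of n e] assms T by blast
  consider "d \<in> polygon_sides n" | "e \<in> polygon_sides n" | "d \<in> T" "e \<in> T"
    using assms by blast
  then show ?thesis
  proof cases
    case 1 then show ?thesis using polygon_side_not_crossing uv' by blast
  next
    case 2 then show ?thesis using polygon_side_not_crossing uv crossing_sym by blast
  next
    case 3 then show ?thesis using T by (auto simp: noncrossing_def)
  qed
qed

lemma triangulation_crossed: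
  assumes "triangulation n T" "d \<in> diagonals n" "d \<notin> T"
  obtains e where "e \<in> T" "crossing d e"
proof -
  have "\<not> noncrossing (insert d T)"
  proof
    assume "noncrossing (insert d T)"
    moreover have "T \<subseteq> insert d T" "insert d T \<subseteq> diagonals n"
      using assms by (auto simp: triangulation_def)
    ultimately have "insert d T = T" using assms(1) unfolding triangulation_def by blast
    with assms(3) show False by blast
  qed
  moreover have "noncrossing T" using assms(1) by (simp add: triangulation_def)
  ultimately have "\<exists>e \<in> T. crossing d e"
    unfolding noncrossing_def using crossing_irrefl crossing_sym by blast
  then show thesis using that by blast
qed

text \<open>Makes the triangle lemmas available at every vertex \<open>p\<close> of a
  triangulation.\<close>

lemma triangulation_maximal_noncrossing:
  assumes n: "3 \<le> n" and T: "triangulation n T" and p: "p < n"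
  shows "maximal_noncrossing n (\<lambda>i j. {rot n p i, rot n p j} \<in> T \<union> polygon_sides n)"
proof
  have sides: "{rot n p i, Suc (rot n p i) mod n} \<in> T \<union> polygon_sides n" for i
    unfolding polygon_sides_def using rot_less[of n p i] n by auto
  have Suc_rot: "Suc (rot n p i) mod n = rot n p (Suc i)" for i
    by (simp add: rot_def mod_Suc_eq)
  show "{rot n p i, rot n p (Suc i)} \<in> T \<union> polygon_sides n" for i
    using sides[of i] Suc_rot by simp
  have "rot n p (Suc (n - 1)) = rot n p 0" using n by (simp add: rot_def)
  then show "{rot n p 0, rot n p (n - 1)} \<in> T \<union> polygon_sides n"
    using sides[of "n - 1"] Suc_rot by (simp add: insert_commute)
next
  fix i k j l assume o: "i < k" "k < j" "j < l" "l < n"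
    and seg: "{rot n p i, rot n p j} \<in> T \<union> polygon_sides n"
      "{rot n p k, rot n p l} \<in> T \<union> polygon_sides n"
  have "crossing {i, j} {k, l}" using o by (simp add: crossing_doubleton)
  then show False using segment_not_crossing[OF n T seg] o p by (simp add: crossing_rot)
next
  fix i j assume o: "i < j" "j < n" and ns: "{rot n p i, rot n p j} \<notin> T \<union> polygon_sides n"
  have "rot n p i \<noteq> rot n p j" "rot n p i < n" "rot n p j < n"
    using o p rot_eq_iff[of p n i j] rot_less[of n p] by auto
  with ns have "{rot n p i, rot n p j} \<in> diagonals n" unfolding diagonals_def by blast
  then obtain e where e: "e \<in> T" "crossing {rot n p i, rot n p j} e"
    using triangulation_crossed[OF T] ns by blast
  have "T \<subseteq> diagonals n" using T by (simp add: triangulation_def)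
  then obtain u v where uv: "e = {u, v}" "u < n" "v < n"
    using segment_doubleton[OF n, of e] e(1) by blast
  obtain k l where kl: "k < n" "l < n" "u = rot n p k" "v = rot n p l"
    using rot_surj[OF p uv(2)] rot_surj[OF p uv(3)] by metis
  \<comment> \<open>Segments are unordered, so the indices may be swapped into increasing
    order.\<close>
  have "\<exists>k l. k \<le> l \<and> l < n \<and> e = {rot n p k, rot n p l}"
  proof (cases "k \<le> l")
    case True then show ?thesis using kl uv by blast
  next
    case False then show ?thesis using kl uv by (intro exI[of _ l] exI[of _ k]) auto
  qed
  then obtain k l where kl: "k \<le> l" "l < n" "e = {rot n p k, rot n p l}" by blast
  then have "crossing {i, j} {k, l}" using e o p by (simp add: crossing_rot)
  then have "k < l \<and> (i < k \<and> k < j \<and> j < l \<or> k < i \<and> i < l \<and> l < j)"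
    using o kl by (auto simp: crossing_doubleton)
  then show "\<exists>k l. k < l \<and> l < n \<and> {rot n p k, rot n p l} \<in> T \<union> polygon_sides n \<and>
      (i < k \<and> k < j \<and> j < l \<or> k < i \<and> i < l \<and> l < j)"
    using kl e by blast
qed

text \<open>\<open>flip\<close> asks for increasing labels, but the rotated quadrilateral may wrap
  past \<open>n\<close>. Renaming its corners cyclically repairs this; an odd shift swaps the two
  diagonals, which the two alternatives in \<open>flip\<close> absorb.\<close>

lemma flip_rot:
  assumes p: "p < n" and o: "i < j" "j < k" "k < l" "l < n"
    and sides: "{rot n p i, rot n p j} \<in> T \<union> polygon_sides n"
      "{rot n p j, rot n p k} \<in> T \<union> polygon_sides n"
      "{rot n p k, rot n p l} \<in> T \<union> polygon_sides n"
      "{rot n p l, rot n p i} \<in> T \<union> polygon_sides n"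
    and d: "{rot n p i, rot n p k} \<in> T"
    and T': "T' = insert {rot n p j, rot n p l} (T - {{rot n p i, rot n p k}})"
  shows "flip n T T'"
proof -
  let ?r = "rot n p"
  have lt: "?r i < n" "?r j < n" "?r k < n" "?r l < n" using rot_less p by auto
  consider "?r i < ?r j" "?r j < ?r k" "?r k < ?r l" | "?r j < ?r k" "?r k < ?r l" "?r l < ?r i"
    | "?r k < ?r l" "?r l < ?r i" "?r i < ?r j" | "?r l < ?r i" "?r i < ?r j" "?r j < ?r k"
  proof -
    \<comment> \<open>The wrapped indices form a final segment of \<open>i, j, k, l\<close>; if all
      four wrap, the order is unchanged.\<close>
    consider "l + p < n" | "k + p < n" "n \<le> l + p" | "j + p < n" "n \<le> k + p"
      | "i + p < n" "n \<le> j + p" | "n \<le> i + p" by linarith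
    then show thesis
    proof cases
      case 1 then show thesis using o p by (intro that(1)) (simp_all add: rot_if)
    next
      case 2 then show thesis using o p by (intro that(4)) (simp_all add: rot_if)
    next
      case 3 then show thesis using o p by (intro that(3)) (simp_all add: rot_if)
    next
      case 4 then show thesis using o p by (intro that(2)) (simp_all add: rot_if)
    next
      case 5 then show thesis using o p by (intro that(1)) (simp_all add: rot_if)
    qed
  qed
  then show ?thesis
  proof cases
    case 1 then show ?thesis unfolding flip_def using lt sides d T'
      by (intro exI[of _ "?r i"] exI[of _ "?r j"] exI[of _ "?r k"] exI[of _ "?r l"]) simp
  next
    case 2 then show ?thesis unfolding flip_def using lt sides d T'
      by (intro exI[of _ "?r j"] exI[of _ "?r k"] exI[of _ "?r l"] exI[of _ "?r i"])
        (simp add: insert_commute)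
  next
    case 3 then show ?thesis unfolding flip_def using lt sides d T'
      by (intro exI[of _ "?r k"] exI[of _ "?r l"] exI[of _ "?r i"] exI[of _ "?r j"])
        (simp add: insert_commute)
  next
    case 4 then show ?thesis unfolding flip_def using lt sides d T'
      by (intro exI[of _ "?r l"] exI[of _ "?r i"] exI[of _ "?r j"] exI[of _ "?r k"])
        (simp add: insert_commute)
  qed
qed

section \<open>Diagonals avoiding a colour\<close>

definition avoiding :: "(nat \<Rightarrow> klein) \<Rightarrow> nat set set \<Rightarrow> nat set set" where
  "avoiding c T = {d \<in> T. 0 \<notin> c ` d}"

lemma segment_colors_differ:
  assumes "polygon_coloring n c" "T \<in> compatible_triangulations n c"
    and "{u, v} \<in> T \<union> polygon_sides n" "u \<noteq> v"
  shows "c u \<noteq> c v"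
proof (cases "{u, v} \<in> T")
  case True
  then have "inj_on c {u, v}"
    using assms(2) by (simp add: compatible_triangulations_def del: inj_on_insert)
  with assms(4) show ?thesis by (simp add: inj_on_def)
next
  case False
  with assms(3) obtain i where "i < n" "{u, v} = {i, Suc i mod n}"
    unfolding polygon_sides_def by blast
  with assms(1) show ?thesis unfolding polygon_coloring_def by (metis doubleton_eq_iff)
qed

text \<open>Pigeonhole: only three elements are nonzero.\<close>

lemma klein_distinct_zero:
  fixes w x y z :: klein
  assumes "distinct [w, x, y, z]"
  shows "0 \<in> {w, x, y, z}"
proof (rule ccontr)
  assume "0 \<notin> {w, x, y, z}"
  then have "{w, x, y, z} \<subseteq> UNIV - {0}" by blast
  moreover have UNIV_klein: "(UNIV :: klein set) = {0, 1} \<times> {0, 1}" using bit.exhaust by auto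
  have card: "card (UNIV :: klein set) = 4" "finite (UNIV :: klein set)"
    unfolding UNIV_klein by simp_all
  then have "card (UNIV - {0 :: klein}) = 3" by (simp add: card_Diff_singleton)
  moreover have "card {w, x, y, z} = 4" using assms by simp
  ultimately show False using card_mono[of "UNIV - {0 :: klein}" "{w, x, y, z}"] card by auto
qed

text \<open>A missing diagonal from a vertex \<open>p\<close> of colour 0 starts inside a triangle
  of \<open>T\<close> at \<open>p\<close> and crosses the opposite side. The ends of that side are
  joined to \<open>p\<close>, hence are not coloured 0.\<close>

lemma crossed_by_avoiding:
  assumes n: "3 \<le> n" and c: "polygon_coloring n c" and T: "T \<in> compatible_triangulations n c"
    and d: "d \<in> diagonals n" "d \<notin> T" "0 \<in> c ` d"
  obtains e where "e \<in> avoiding c T" "crossing d e"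
proof -
  have tr: "triangulation n T" using T by (simp add: compatible_triangulations_def)
  obtain p x where px: "d = {p, x}" "p < n" "x < n" "p \<noteq> x" "c p = 0"
  proof -
    from d(1) n obtain u v where uv: "d = {u, v}" "u < n" "v < n" "u \<noteq> v"
      using segment_doubleton by blast
    with d(3) consider "c u = 0" | "c v = 0" by auto
    then show thesis using that[of u v] that[of v u] uv by cases auto
  qed
  interpret maximal_noncrossing n "\<lambda>i j. {rot n p i, rot n p j} \<in> T \<union> polygon_sides n"
    by (rule triangulation_maximal_noncrossing[OF n tr px(2)])
  obtain i where i: "i < n" "x = rot n p i" using rot_surj px by blast
  have "0 < i" using px i rot_0 by (cases i) auto
  have "{rot n p 0, rot n p i} \<notin> T \<union> polygon_sides n"
    using d px i by (auto simp: rot_0 diagonals_def)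
  then obtain a b where ab: "0 < a" "a < i" "i < b" "b < n"
    and seg: "{rot n p 0, rot n p a} \<in> T \<union> polygon_sides n"
      "{rot n p 0, rot n p b} \<in> T \<union> polygon_sides n"
      "{rot n p a, rot n p b} \<in> T \<union> polygon_sides n"
    using triangle_at_origin[of i] \<open>0 < i\<close> i by blast
  have "crossing {0, i} {a, b}" using ab by (simp add: crossing_doubleton)
  then have cr: "crossing d {rot n p a, rot n p b}"
    using crossing_rot[of p n 0 i a b] ab px i by (simp add: rot_0)
  have "rot n p a < n" "rot n p b < n" using rot_less n by simp_all
  \<comment> \<open>The opposite side is crossed, so it is a genuine diagonal.\<close>
  then have "{rot n p a, rot n p b} \<notin> polygon_sides n"
    using polygon_side_not_crossing px(1-3) cr crossing_sym by blast
  with seg have "{rot n p a, rot n p b} \<in> T" by blast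
  moreover have "c (rot n p a) \<noteq> 0" "c (rot n p b) \<noteq> 0"
    using segment_colors_differ[OF c T seg(1)] segment_colors_differ[OF c T seg(2)] ab px
      rot_eq_iff[of p n 0 a] rot_eq_iff[of p n 0 b] by (auto simp: rot_0)
  ultimately have "{rot n p a, rot n p b} \<in> avoiding c T" by (auto simp: avoiding_def)
  then show thesis using that cr by blast
qed

text \<open>A diagonal of \<open>T'\<close> with an end of colour 0 that is missing from
  \<open>T\<close> would be crossed by a member of \<open>avoiding c T\<close>, which also lies in
  \<open>T'\<close>.\<close>

lemma diff_avoiding_subset:
  assumes n: "3 \<le> n" and c: "polygon_coloring n c"
    and T: "T \<in> compatible_triangulations n c" and T': "T' \<in> compatible_triangulations n c"
    and sub: "avoiding c T \<subseteq> avoiding c T'"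
  shows "T' - avoiding c T' \<subseteq> T"
proof
  fix d assume d: "d \<in> T' - avoiding c T'"
  have tr: "T' \<subseteq> diagonals n" "noncrossing T'"
    using T' by (auto simp: compatible_triangulations_def triangulation_def)
  show "d \<in> T"
  proof (rule ccontr)
    assume "d \<notin> T"
    moreover have "d \<in> diagonals n" "0 \<in> c ` d" using d tr by (auto simp: avoiding_def)
    ultimately obtain e where "e \<in> avoiding c T" "crossing d e"
      using crossed_by_avoiding[OF n c T] by blast
    with sub d tr(2) show False by (auto simp: avoiding_def noncrossing_def)
  qed
qed

section \<open>Injectivity of the labelling, and flips as one-element changes\<close>

lemma avoiding_inj:
  assumes "3 \<le> n" "polygon_coloring n c"
  shows "inj_on (avoiding c) (compatible_triangulations n c)"
proof (rule inj_onI)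
  fix T T' assume T: "T \<in> compatible_triangulations n c" "T' \<in> compatible_triangulations n c"
    and eq: "avoiding c T = avoiding c T'"
  have "avoiding c T \<subseteq> T" "avoiding c T' \<subseteq> T'" by (auto simp: avoiding_def)
  then show "T = T'"
    using diff_avoiding_subset[OF assms T] diff_avoiding_subset[OF assms T(2,1)] eq by blast
qed

text \<open>The new diagonal \<open>d\<close> lies between two triangles of \<open>T'\<close>. The
  other four sides of these survive in \<open>T\<close>, so the only diagonal of \<open>T\<close>
  that can cross \<open>d\<close> is the other diagonal of their quadrilateral.\<close>

lemma avoiding_insert_flip:
  assumes n: "3 \<le> n" and c: "polygon_coloring n c"
    and T: "T \<in> compatible_triangulations n c" and T': "T' \<in> compatible_triangulations n c"
    and ins: "avoiding c T' = insert d (avoiding c T)" "d \<notin> avoiding c T"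
  shows "flip n T T'"
proof -
  have tr: "triangulation n T" "triangulation n T'"
    using T T' by (auto simp: compatible_triangulations_def)
  then have diag: "T \<subseteq> diagonals n" "T' \<subseteq> diagonals n" by (auto simp: triangulation_def)
  have d: "d \<in> T'" "d \<notin> T" "0 \<notin> c ` d" using ins by (auto simp: avoiding_def)
  have sub: "T' - {d} \<subseteq> T"
    using diff_avoiding_subset[OF n c T T'] ins by (auto simp: avoiding_def)
  obtain e where e: "e \<in> T" "crossing d e"
    using triangulation_crossed[OF tr(1)] d diag by blast
  have "e \<notin> T'" using e d(1) segment_not_crossing[OF n tr(2)] by blast
  \<comment> \<open>Otherwise \<open>e\<close> would lie in \<open>avoiding c T\<close> and hence in
    \<open>T'\<close>.\<close>
  then have "0 \<in> c ` e" using e(1) ins by (auto simp: avoiding_def)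
  obtain p x where px: "e = {p, x}" "p < n" "x < n" "p \<noteq> x" "c p = 0"
  proof -
    from e(1) n diag obtain u v where uv: "e = {u, v}" "u < n" "v < n" "u \<noteq> v"
      using segment_doubleton by blast
    with \<open>0 \<in> c ` e\<close> consider "c u = 0" | "c v = 0" by auto
    then show thesis using that[of u v] that[of v u] uv by cases auto
  qed
  let ?r = "rot n p"
  interpret T: maximal_noncrossing n "\<lambda>i j. {?r i, ?r j} \<in> T \<union> polygon_sides n"
    by (rule triangulation_maximal_noncrossing[OF n tr(1) px(2)])
  interpret T': maximal_noncrossing n "\<lambda>i j. {?r i, ?r j} \<in> T' \<union> polygon_sides n"
    by (rule triangulation_maximal_noncrossing[OF n tr(2) px(2)])
  obtain i where i: "i < n" "x = ?r i" using rot_surj px by blast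
  have e_eq: "e = {?r 0, ?r i}" using px i by (simp add: rot_0)
  have "0 < i" using px i rot_0 by (cases i) auto
  have "e \<notin> T' \<union> polygon_sides n" using \<open>e \<notin> T'\<close> e(1) diag by (auto simp: diagonals_def)
  then obtain a b where ab: "0 < a" "a < i" "i < b" "b < n"
    and seg': "{?r 0, ?r a} \<in> T' \<union> polygon_sides n" "{?r 0, ?r b} \<in> T' \<union> polygon_sides n"
      "{?r a, ?r b} \<in> T' \<union> polygon_sides n"
    using T'.triangle_at_origin[of i] \<open>0 < i\<close> i e_eq by blast
  have "crossing {0, i} {a, b}" using ab by (simp add: crossing_doubleton)
  then have "crossing e {?r a, ?r b}"
    using crossing_rot[of p n 0 i a b] ab px i e_eq by simp
  then have "{?r a, ?r b} \<notin> T \<union> polygon_sides n"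
    using segment_not_crossing[OF n tr(1)] e(1) by blast
  \<comment> \<open>\<open>d\<close> is the only segment of \<open>T'\<close> that can be absent
    from \<open>T\<close>.\<close>
  with seg'(3) sub have d_eq: "d = {?r a, ?r b}" by blast
  \<comment> \<open>The triangle of \<open>T'\<close> on the side of \<open>d\<close> away from
    \<open>p\<close>; the quadrilateral is \<open>0, a, y, b\<close>.\<close>
  obtain y where y: "a < y" "y < b" "{?r a, ?r y} \<in> T' \<union> polygon_sides n"
      "{?r y, ?r b} \<in> T' \<union> polygon_sides n"
    using T'.triangle_below[OF seg'(3)] ab by auto
  have "{?r u, ?r v} \<noteq> d" if "u < n" "v < n" "{u, v} \<noteq> {a, b}" for u v
    using that ab px(2) unfolding d_eq doubleton_eq_iff by (auto simp: rot_eq_iff)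
  then have to_T: "{?r u, ?r v} \<in> T \<union> polygon_sides n"
    if "{?r u, ?r v} \<in> T' \<union> polygon_sides n" "u < n" "v < n" "{u, v} \<noteq> {a, b}" for u v
    using that sub by blast
  have seg: "{?r 0, ?r a} \<in> T \<union> polygon_sides n" "{?r 0, ?r b} \<in> T \<union> polygon_sides n"
    "{?r a, ?r y} \<in> T \<union> polygon_sides n" "{?r y, ?r b} \<in> T \<union> polygon_sides n"
    using to_T[OF seg'(1)] to_T[OF seg'(2)] to_T[OF y(3)] to_T[OF y(4)] y(1,2) ab
    by (simp_all add: doubleton_eq_iff)
  \<comment> \<open>Any other segment crossing \<open>d\<close> would cross one of the sides
    \<open>0 a\<close>, \<open>a y\<close>, \<open>y b\<close>, \<open>0 b\<close>, which all belong
    to \<open>T\<close> or the polygon.\<close>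
  have crosses_d: "g = {?r 0, ?r y}" if g: "g \<in> T" "crossing d g" for g
  proof -
    obtain u v where uv: "g = {u, v}" "u < n" "v < n"
      using segment_doubleton[OF n, of g] g(1) diag by blast
    obtain k l where "k < n" "l < n" "u = ?r k" "v = ?r l"
      using rot_surj[OF px(2) uv(2)] rot_surj[OF px(2) uv(3)] by metis
    then obtain k l where kl: "k \<le> l" "l < n" "g = {?r k, ?r l}"
      using uv(1) by (metis insert_commute nle_le)
    have "crossing {a, b} {k, l}"
      using g(2) crossing_rot[of p n a b k l] kl ab px(2) unfolding d_eq by simp
    then consider "a < k" "k < b" "b < l" | "k < a" "a < l" "l < b"
      using ab kl(1) by (auto simp: crossing_doubleton)
    then show ?thesis
    proof cases
      case 1
      then show ?thesis using T.not_cross[of 0 k b l] seg kl g(1) by auto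
    next
      case 2
      then have "k = 0" using T.not_cross[of 0 k a l] seg kl g(1) by auto
      moreover have "\<not> l < y" using T.not_cross[of 0 a l y] 2 seg kl g(1) y ab \<open>k = 0\<close> by auto
      moreover have "\<not> y < l" using T.not_cross[of 0 y l b] 2 seg kl g(1) y ab \<open>k = 0\<close> by auto
      ultimately show ?thesis using kl by simp
    qed
  qed
  have e_y: "e = {?r 0, ?r y}" using crosses_d e by blast
  \<comment> \<open>A lost diagonal is crossed by some \<open>d'\<close> of \<open>T'\<close>
    outside \<open>T\<close>, which must be \<open>d\<close>; so it crosses \<open>d\<close> and
    equals \<open>e\<close>.\<close>
  have "g = e" if g: "g \<in> T" "g \<notin> T'" for g
  proof -
    obtain d' where d': "d' \<in> T'" "crossing g d'"
      using triangulation_crossed[OF tr(2)] g diag by blast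
    then have "d' \<notin> T" using g segment_not_crossing[OF n tr(1)] by blast
    with d' sub have "crossing d g" using crossing_sym by blast
    with g crosses_d e_y show ?thesis by blast
  qed
  then have "T' = insert {?r a, ?r b} (T - {{?r 0, ?r y}})"
    using sub d e(1) \<open>e \<notin> T'\<close> unfolding e_y d_eq by blast
  then show ?thesis
    using flip_rot[OF px(2), of 0 a y b T T'] ab y seg e(1) unfolding e_y
    by (simp add: insert_commute)
qed

text \<open>The corners of the quadrilateral use all four colours, so exactly one of its two
  diagonals has an end of colour 0.\<close>

lemma flip_avoiding:
  assumes n: "3 \<le> n" and c: "polygon_coloring n c"
    and T: "T \<in> compatible_triangulations n c" and T': "T' \<in> compatible_triangulations n c"
    and fl: "flip n T T'"
  shows "\<exists>d. (avoiding c T - avoiding c T') \<union> (avoiding c T' - avoiding c T) = {d}"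
proof -
  from fl obtain p q r s where o: "p < q" "q < r" "r < s" "s < n"
    and sides: "{{p, q}, {q, r}, {r, s}, {s, p}} \<subseteq> T \<union> polygon_sides n"
    and T'_eq: "({p, r} \<in> T \<and> T' = insert {q, s} (T - {{p, r}})) \<or>
             ({q, s} \<in> T \<and> T' = insert {p, r} (T - {{q, s}}))"
    unfolding flip_def by (elim exE conjE) (rule that)
  have "crossing {p, r} {q, s}" using o by (simp add: crossing_doubleton)
  moreover have "triangulation n T" using T by (simp add: compatible_triangulations_def)
  ultimately have nb: "\<not> ({p, r} \<in> T \<and> {q, s} \<in> T)"
    using segment_not_crossing[OF n] by blast
  \<comment> \<open>Each of the two diagonals belongs to one of \<open>T\<close> and
    \<open>T'\<close>, and both triangulations are compatible.\<close>
  have "c p \<noteq> c r" "c q \<noteq> c s"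
    using segment_colors_differ[OF c T, of p r] segment_colors_differ[OF c T', of p r]
      segment_colors_differ[OF c T, of q s] segment_colors_differ[OF c T', of q s] T'_eq o by auto
  moreover have "c p \<noteq> c q" "c q \<noteq> c r" "c r \<noteq> c s" "c s \<noteq> c p"
    using segment_colors_differ[OF c T] sides o by auto
  ultimately have dist: "distinct [c p, c q, c r, c s]" by auto
  then have "(0 \<in> c ` {p, r}) \<noteq> (0 \<in> c ` {q, s})"
    using klein_distinct_zero[OF dist] by auto
  moreover have "{p, r} \<noteq> {q, s}" using o by (auto simp: doubleton_eq_iff)
  ultimately show ?thesis
    using T'_eq nb
  proof (elim disjE conjE, goal_cases)
    case 1
    show ?case
    proof (cases "0 \<in> c ` {p, r}")
      case True
      with 1 show ?thesis unfolding avoiding_def by (intro exI[of _ "{q, s}"]) blast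
    next
      case False
      with 1 show ?thesis unfolding avoiding_def by (intro exI[of _ "{p, r}"]) blast
    qed
  next
    case 2
    show ?case
    proof (cases "0 \<in> c ` {p, r}")
      case True
      with 2 show ?thesis unfolding avoiding_def by (intro exI[of _ "{q, s}"]) blast
    next
      case False
      with 2 show ?thesis unfolding avoiding_def by (intro exI[of _ "{p, r}"]) blast
    qed
  qed
qed

section \<open>The embedding\<close>

text \<open>Reduces the embedding to an injective labelling by subsets of \<open>S\<close> under
  which adjacency means differing in one element; \<open>H\<close> is the image of
  \<open>G\<close>.\<close>

lemma induced_subgraph_hypercubeI:
  fixes G :: "'a pair_pre_digraph" and f :: "'a \<Rightarrow> 'b set"
  assumes wf: "wf_digraph (with_proj G)" and S: "finite S"
    and f: "f ` pverts G \<subseteq> Pow S" "inj_on f (pverts G)"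
    and arcs: "\<And>u v. u \<in> pverts G \<Longrightarrow> v \<in> pverts G \<Longrightarrow>
      (u, v) \<in> parcs G \<longleftrightarrow> (\<exists>x. (f u - f v) \<union> (f v - f u) = {x})"
  shows "\<exists>H. induced_subgraph H (with_proj (hypercube S)) \<and> digraph_iso (with_proj G) H"
proof (intro exI conjI)
  \<comment> \<open>Arcs are pairs of vertices; keeping the projections as tail and head makes the
    image compatible with the hypercube.\<close>
  let ?h = "\<lparr>iso_verts = f, iso_arcs = map_prod f f, iso_head = snd, iso_tail = fst\<rparr>"
  let ?H = "app_iso ?h (with_proj G)"
  interpret wf_digraph "with_proj G" by (rule wf)
  have ends: "u \<in> pverts G" "v \<in> pverts G" if "(u, v) \<in> parcs G" for u v
    using wellformed[of "(u, v)"] that by simp_all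
  have "parcs G \<subseteq> pverts G \<times> pverts G" using ends by auto
  then have "inj_on (map_prod f f) (parcs G)"
    using map_prod_inj_on[OF f(2) f(2)] inj_on_subset by blast
  then have iso: "digraph_isomorphism ?h"
    unfolding digraph_isomorphism_def using f wf by auto
  then show "digraph_iso (with_proj G) ?H" unfolding digraph_iso_def by blast
  have arcs_H: "arcs ?H = {e \<in> arcs (with_proj (hypercube S)).
      fst e \<in> verts ?H \<and> snd e \<in> verts ?H}" (is "_ = ?R")
  proof (rule set_eqI, rule iffI)
    fix e assume "e \<in> arcs ?H"
    then obtain u v where uv: "(u, v) \<in> parcs G" "e = (f u, f v)"
      by (auto simp: arcs_app_iso)
    with ends[OF uv(1)] arcs[of u v] f(1) show "e \<in> ?R"
      by (auto simp: verts_app_iso hypercube_def)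
  next
    fix e assume e: "e \<in> ?R"
    then obtain u v where uv: "u \<in> pverts G" "v \<in> pverts G" "e = (f u, f v)"
      by (cases e) (auto simp: verts_app_iso)
    with e arcs[of u v] have "(u, v) \<in> parcs G" by (simp add: hypercube_def)
    then have "map_prod f f (u, v) \<in> map_prod f f ` parcs G" by (rule imageI)
    then show "e \<in> arcs ?H" using uv by (simp add: arcs_app_iso)
  qed
  interpret cube: pair_graph "hypercube S" by (rule pair_graph_hypercube[OF S])
  have "wf_digraph (with_proj (hypercube S))" by (rule cube.wf_digraph_axioms)
  moreover have "wf_digraph ?H" using iso by (rule wf_digraphI_app_iso)
  ultimately show "induced_subgraph ?H (with_proj (hypercube S))"
    unfolding induced_subgraph_def subgraph_def compatible_def
    using arcs_H f(1)
    by (simp add: verts_app_iso tail_app_iso head_app_iso) (auto simp: hypercube_def)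
qed

lemma sym_diff_singleton:
  assumes "(A - B) \<union> (B - A) = {d}"
  shows "B = insert d A \<and> d \<notin> A \<or> A = insert d B \<and> d \<notin> B"
proof -
  have *: "x \<in> A \<and> x \<notin> B \<or> x \<in> B \<and> x \<notin> A \<longleftrightarrow> x = d" for x
    using assms by (simp add: set_eq_iff)
  show ?thesis
  proof (cases "d \<in> A")
    case True
    then have "x \<in> A \<longleftrightarrow> x = d \<or> x \<in> B" for x using *[of x] *[of d] by metis
    with True *[of d] show ?thesis by (simp add: set_eq_iff)
  next
    case False
    then have "x \<in> B \<longleftrightarrow> x = d \<or> x \<in> A" for x using *[of x] *[of d] by metis
    with False show ?thesis by (simp add: set_eq_iff)
  qed
qed

theorem theorem2:
  fixes n :: nat and c :: "nat \<Rightarrow> klein"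
  assumes "n \<ge> 3" and "polygon_coloring n c"
  shows "\<exists>(S :: nat set) H. finite S \<and>
           induced_subgraph H (with_proj (hypercube S)) \<and>
           digraph_iso (with_proj (color_graph n c)) H"
proof -
  let ?G = "color_graph n c"
  let ?V = "compatible_triangulations n c"
  \<comment> \<open>The ground set of the cube must consist of numbers, so the diagonals are encoded
    injectively.\<close>
  obtain g :: "nat set \<Rightarrow> nat" where g: "inj_on g (diagonals n)"
    using finite_imp_inj_to_nat_seg[OF finite_diagonals[of n]] by blast
  have sub: "avoiding c T \<subseteq> diagonals n" if "T \<in> ?V" for T
    using that by (auto simp: avoiding_def compatible_triangulations_def triangulation_def)
  interpret color: pair_graph ?G by (rule pair_graph_color_graph)
  have "\<exists>H. induced_subgraph H (with_proj (hypercube (g ` diagonals n))) \<and>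
      digraph_iso (with_proj ?G) H"
  proof (rule induced_subgraph_hypercubeI[where f = "\<lambda>T. g ` avoiding c T"])
    show "wf_digraph (with_proj ?G)" by (rule color.wf_digraph_axioms)
    show "finite (g ` diagonals n)" by (simp add: finite_diagonals)
    show "(\<lambda>T. g ` avoiding c T) ` pverts ?G \<subseteq> Pow (g ` diagonals n)"
      using sub by (auto simp: color_graph_def)
    have "inj_on ((`) g) (avoiding c ` ?V)"
      using inj_on_image_Pow[OF g] sub by (auto intro: inj_on_subset)
    then show "inj_on (\<lambda>T. g ` avoiding c T) (pverts ?G)"
      using comp_inj_on[OF avoiding_inj[OF assms]] by (simp add: color_graph_def o_def)
    fix T T' assume "T \<in> pverts ?G" "T' \<in> pverts ?G"
    then have V: "T \<in> ?V" "T' \<in> ?V" by (simp_all add: color_graph_def)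
    let ?D = "(avoiding c T - avoiding c T') \<union> (avoiding c T' - avoiding c T)"
    have D: "(g ` avoiding c T - g ` avoiding c T') \<union>
        (g ` avoiding c T' - g ` avoiding c T) = g ` ?D"
    proof -
      have "g ` (avoiding c T - avoiding c T') = g ` avoiding c T - g ` avoiding c T'"
        "g ` (avoiding c T' - avoiding c T) = g ` avoiding c T' - g ` avoiding c T"
        using sub[OF V(1)] sub[OF V(2)] by (intro inj_on_image_set_diff[OF g]; blast)+
      then show ?thesis by (simp only: image_Un)
    qed
    have "flip n T T' \<longleftrightarrow> (\<exists>d. ?D = {d})"
    proof
      assume "flip n T T'"
      then show "\<exists>d. ?D = {d}" by (rule flip_avoiding[OF assms V])
    next
      assume "\<exists>d. ?D = {d}"
      then obtain d where d: "?D = {d}" by blast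
      then consider "avoiding c T' = insert d (avoiding c T)" "d \<notin> avoiding c T"
        | "avoiding c T = insert d (avoiding c T')" "d \<notin> avoiding c T'"
        using sym_diff_singleton by metis
      then show "flip n T T'"
      proof cases
        case 1
        then show ?thesis by (rule avoiding_insert_flip[OF assms V])
      next
        case 2
        then have "flip n T' T" by (rule avoiding_insert_flip[OF assms V(2,1)])
        moreover have "noncrossing T'"
          using V by (simp add: compatible_triangulations_def triangulation_def)
        ultimately show ?thesis by (rule flip_sym_neq(1)[rotated])
      qed
    qed
    \<comment> \<open>Passing to codes preserves the size of the symmetric difference.\<close>
    also have "\<dots> \<longleftrightarrow> (\<exists>x. g ` ?D = {x})"
    proof
      assume "\<exists>x. g ` ?D = {x}"
      then obtain x where x: "g ` ?D = {x}" by blast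
      have "inj_on g ?D" using g sub[OF V(1)] sub[OF V(2)] by (auto intro: inj_on_subset)
      then have "card ?D = 1" using card_image[of g ?D] x by simp
      then show "\<exists>d. ?D = {d}" by (simp add: card_1_singleton_iff)
    qed auto
    finally show "(T, T') \<in> parcs ?G \<longleftrightarrow> (\<exists>x. (g ` avoiding c T - g ` avoiding c T') \<union>
        (g ` avoiding c T' - g ` avoiding c T) = {x})"
      using V unfolding D by (simp add: color_graph_def)
  qed
  then show ?thesis using finite_imageI[OF finite_diagonals] by meson
qed

end
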